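(* Let $E$ be a quasi-convex function. Then, for function spaces over $(0,\infty)$ with Lebesgue measure, $$\Lambda^E=\bigcup\{L^A: A\text{ is a Young function such that } L^A\hookrightarrow\Lambda^E\}.$$
   Context: A function $A:[0,\infty]\to[0,\infty]$ is quasi-convex if it is left-continuous, not identically zero or infinity on $(0,\infty]$, $A(0)=0$, and $t\mapsto A(t)/t$ is non-decreasing on $(0,\infty)$; it is a Young function if moreover it is convex. For measurable $f:(0,\infty)\to[-\infty,\infty]$, $f_*(\lambda)=|\{|f|>\lambda\}|$. For quasi-convex $A$: - $\|f\|_{L^A}=\inf\{\lambda>0:\int_0^\infty A(|f|/\lambda)\le1\}$ and $L^A=\{f:\|f\|_{L^A}<\infty\}$ (Orlicz space); - $A^{-1}(t)=\sup\{\tau\ge0:A(\tau)\le t\}$ is the right-continuous inverse, $A^{-1}_\#(t)=1/A^{-1}(1/t)$ for $t\in[0,\infty]$ (with $1/0=\infty$, $1/\infty=0$), $\|f\|_{\Lambda^A}=\int_0^\infty A^{-1}_\#(f_*(\lambda))\,d\lambda$ and $\Lambda^A=\{f:\|f\|_{\Lambda^A}<\infty\}$ (strong Orlicz, or Lorentz, space). $X\hookrightarrow Y$ means that there is $C>0$ with $\|f\|_Y\le C\|f\|_X$ for every $f\in X$. *)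

theory Defs
  imports "HOL-Analysis.Analysis"
begin

definition quasi_convex :: "(ennreal \<Rightarrow> ennreal) \<Rightarrow> bool" where
  "quasi_convex A \<longleftrightarrow>
     (\<forall>t>0. continuous (at_left t) A) \<and>
     (\<exists>t>0. A t \<noteq> 0) \<and> (\<exists>t>0. A t \<noteq> \<infinity>) \<and>
     A 0 = 0 \<and>
     mono_on {0<..<\<infinity>} (\<lambda>t. A t / t)"

(* Convexity is spelled out because ennreal is not a real vector space. *)
definition young_function :: "(ennreal \<Rightarrow> ennreal) \<Rightarrow> bool" where
  "young_function A \<longleftrightarrow> quasi_convex A \<and>
     (\<forall>u v s t. u + v = 1 \<longrightarrow> A (u * s + v * t) \<le> u * A s + v * A t)"

(* Functions on (0,\<infinity>) are total functions on the reals; since everything below is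
   taken with respect to this measure, their values outside (0,\<infinity>) are irrelevant. *)
abbreviation half_line :: "real measure" where
  "half_line \<equiv> lebesgue_on {0<..}"

abbreviation absval :: "(real \<Rightarrow> ereal) \<Rightarrow> real \<Rightarrow> ennreal" where
  "absval f x \<equiv> e2ennreal \<bar>f x\<bar>"

definition distribution_fun :: "(real \<Rightarrow> ereal) \<Rightarrow> real \<Rightarrow> ennreal" where
  "distribution_fun f l = emeasure half_line {x \<in> space half_line. \<bar>f x\<bar> > ereal l}"

definition orlicz_norm :: "(ennreal \<Rightarrow> ennreal) \<Rightarrow> (real \<Rightarrow> ereal) \<Rightarrow> ennreal" where
  "orlicz_norm A f =
     Inf {l. 0 < l \<and> l < \<infinity> \<and> (\<integral>\<^sup>+ x. A (absval f x / l) \<partial>half_line) \<le> 1}"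

definition right_inverse :: "(ennreal \<Rightarrow> ennreal) \<Rightarrow> ennreal \<Rightarrow> ennreal" where
  "right_inverse A t = Sup {\<tau>. A \<tau> \<le> t}"

(* In ennreal, 1 / 0 = \<infinity> and 1 / \<infinity> = 0. *)
definition inverse_sharp :: "(ennreal \<Rightarrow> ennreal) \<Rightarrow> ennreal \<Rightarrow> ennreal" where
  "inverse_sharp A t = 1 / right_inverse A (1 / t)"

definition lorentz_norm :: "(ennreal \<Rightarrow> ennreal) \<Rightarrow> (real \<Rightarrow> ereal) \<Rightarrow> ennreal" where
  "lorentz_norm A f = (\<integral>\<^sup>+ l. inverse_sharp A (distribution_fun f l) \<partial>half_line)"

definition fun_space :: "((real \<Rightarrow> ereal) \<Rightarrow> ennreal) \<Rightarrow> (real \<Rightarrow> ereal) set" where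
  "fun_space N = {f \<in> borel_measurable half_line. N f < \<infinity>}"

definition orlicz_space :: "(ennreal \<Rightarrow> ennreal) \<Rightarrow> (real \<Rightarrow> ereal) set" where
  "orlicz_space A = fun_space (orlicz_norm A)"

definition lorentz_space :: "(ennreal \<Rightarrow> ennreal) \<Rightarrow> (real \<Rightarrow> ereal) set" where
  "lorentz_space A = fun_space (lorentz_norm A)"

(* Both spaces are given by their norms, as in fun_space. *)
definition embeds ::
  "((real \<Rightarrow> ereal) \<Rightarrow> ennreal) \<Rightarrow> ((real \<Rightarrow> ereal) \<Rightarrow> ennreal) \<Rightarrow> bool" where
  "embeds N N' \<longleftrightarrow> (\<exists>C::real. C > 0 \<and> (\<forall>f\<in>fun_space N. N' f \<le> ennreal C * N f))"

end

theory Submission imports Defs begin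

text \<open>
  Write \<open>\<Phi>\<close> for \<open>inverse_sharp E\<close>, so that the Lorentz norm of \<open>f\<close> is the integral of
  \<open>\<Phi>(f\<^sub>*)\<close> with \<open>f\<^sub>*\<close> the distribution function. One inclusion is immediate from the
  embedding. For the other one, given \<open>f\<close> in the Lorentz space, a Young function has to be
  found which is small enough to admit \<open>f\<close> and large enough for its Orlicz space to embed.

  The point is that \<open>\<Phi>\<close> is quasi-concave: \<open>\<Phi>\<close> is non-decreasing and \<open>\<Phi>(s)/s\<close> is
  non-increasing. Hence, for \<open>0 < r < \<infinity>\<close>,
  \[ \Phi(s) \le \max(1, s/r)\, \Phi(r) \le \Phi(r) + s\, \Phi(r)/r, \]
  a bound affine in \<open>s\<close> (\<open>inverse_sharp_le_tangent\<close>). Take a non-increasing \<open>m \<ge> f\<^sub>*\<close> for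
  which \<open>\<Phi>(m)\<close> is integrable, with integral \<open>K\<close>, and let \<open>A\<close> be the primitive of
  \<open>a(\<lambda>) = \<Phi>(m(\<lambda>))/m(\<lambda>)\<close>. As \<open>m\<close> is non-increasing, \<open>a\<close> is non-decreasing, so \<open>A\<close> is convex
  (\<open>young_function_primitive\<close>). By Fubini the integral of \<open>A(|g|)\<close> is that of \<open>a g\<^sub>*\<close>
  (\<open>primitive_layer_cake\<close>). For \<open>g = f\<close> this is at most the integral of \<open>a m = \<Phi>(m)\<close>, that is
  \<open>K\<close>, so \<open>f\<close> belongs to the Orlicz space of \<open>A\<close>. If the integral of \<open>A(|g|)\<close> is at most \<open>1\<close>,
  the affine bound with \<open>s = g\<^sub>*(\<lambda>)\<close> and \<open>r = m(\<lambda>)\<close> integrates to a Lorentz norm of at most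
  \<open>K + 1\<close>, and dilation gives the embedding with constant \<open>K + 1\<close>
  (\<open>embeds_primitive_sharp_slope\<close>).

  The choice \<open>m = f\<^sub>*\<close> would do, except that \<open>A\<close> degenerates to \<open>\<infinity>\<close> if \<open>f\<close> vanishes almost
  everywhere. Taking the maximum of \<open>f\<^sub>*\<close> and the distribution function of the indicator of a
  short interval avoids this.
\<close>

section \<open>Integration over the half-line\<close>

lemma borel_measurable_mono_ennreal:
  fixes f :: "real \<Rightarrow> ennreal"
  assumes "mono f"
  shows "f \<in> borel_measurable borel"
proof (rule borel_measurableI_greater)
  fix y
  have "is_interval {x. y < f x}"
    unfolding is_interval_1 using assms by (auto simp: mono_def intro: less_le_trans)
  then show "{x \<in> space borel. y < f x} \<in> sets borel"
    by (simp add: real_interval_borel_measurable)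
qed

lemma borel_measurable_antimono_ennreal:
  fixes f :: "real \<Rightarrow> ennreal"
  assumes "antimono f"
  shows "f \<in> borel_measurable borel"
proof (rule borel_measurableI_greater)
  fix y
  have "is_interval {x. y < f x}"
    unfolding is_interval_1 using assms by (auto simp: antimono_def intro: less_le_trans)
  then show "{x \<in> space borel. y < f x} \<in> sets borel"
    by (simp add: real_interval_borel_measurable)
qed

lemma measurable_half_line_if_borel:
  "f \<in> borel_measurable borel \<Longrightarrow> f \<in> borel_measurable half_line"
  by (intro measurable_restrict_space1 measurable_completion) simp

lemma sigma_finite_half_line: "sigma_finite_measure half_line"
proof (rule sigma_finite_measure_restrict_space)
  show "sigma_finite_measure (lebesgue :: real measure)"
  proof
    show "\<exists>A::real set set. countable A \<and> A \<subseteq> sets lebesgue \<and> \<Union>A = space lebesgue \<and>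
        (\<forall>a\<in>A. emeasure lebesgue a \<noteq> \<infinity>)"
      by (rule exI[of _ "range (\<lambda>n::nat. cball 0 (real n))"])
        (auto simp: emeasure_cball intro: real_arch_simple)
  qed
qed simp

lemma nn_integral_half_line_scale:
  assumes "h \<in> borel_measurable borel" "0 < c"
  shows "(\<integral>\<^sup>+ l. h l \<partial>half_line) = ennreal c * (\<integral>\<^sup>+ l. h (c * l) \<partial>half_line)"
proof -
  have [measurable]: "h \<in> borel_measurable lebesgue"
    using assms(1) by (intro measurable_completion) simp
  have "(\<integral>\<^sup>+ l. h l \<partial>half_line) = (\<integral>\<^sup>+ l. h l * indicator {0<..} l \<partial>lebesgue)"
    by (rule nn_integral_restrict_space) simp
  also have "\<dots> = ennreal \<bar>c\<bar> * (\<integral>\<^sup>+ l. h (0 + c * l) * indicator {0<..} (0 + c * l) \<partial>lebesgue)"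
    using assms(2) by (intro nn_integral_real_affine_lebesgue borel_measurable_times_ennreal
        borel_measurable_indicator) auto
  also have "(\<integral>\<^sup>+ l. h (0 + c * l) * indicator {0<..} (0 + c * l) \<partial>lebesgue) =
      (\<integral>\<^sup>+ l. h (c * l) * indicator {0<..} l \<partial>lebesgue)"
    using assms(2) by (intro nn_integral_cong) (auto simp: indicator_def zero_less_mult_iff)
  also have "\<dots> = (\<integral>\<^sup>+ l. h (c * l) \<partial>half_line)"
    by (rule nn_integral_restrict_space[symmetric]) simp
  finally show ?thesis using assms(2) by simp
qed

lemma sets_half_line_Iio: "{l \<in> space half_line. ennreal l < t} \<in> sets half_line"
proof -
  have [measurable]: "ennreal \<in> borel_measurable half_line"
    by (rule measurable_half_line_if_borel) simp
  show ?thesis by measurable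
qed

lemma emeasure_half_line_Iio:
  "emeasure half_line {l \<in> space half_line. ennreal l < t} = t"
proof (cases t)
  case (real r)
  have "{l \<in> space half_line. ennreal l < t} = {0<..<r}"
    using real by (auto simp: space_restrict_space ennreal_less_iff)
  moreover have "emeasure half_line {0<..<r} = emeasure lebesgue {0<..<r}"
    by (rule emeasure_restrict_space) auto
  ultimately show ?thesis using real by simp
next
  case top
  have "{l \<in> space half_line. ennreal l < t} = {0<..}"
    using top by (auto simp: space_restrict_space)
  moreover have "emeasure lborel {0::real<..} = \<infinity>"
  proof -
    have "x \<le> emeasure lborel {0::real<..}" if x: "x < top" for x
    proof -
      obtain r where r: "x = ennreal r" "0 \<le> r" using x by (cases x) auto
      have "emeasure lborel {0<..<r} \<le> emeasure lborel {0::real<..}"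
        by (rule emeasure_mono) auto
      then show ?thesis using r by simp
    qed
    then have "top \<le> emeasure lborel {0::real<..}" by (rule dense_le)
    then show ?thesis by (simp add: top_unique)
  qed
  ultimately show ?thesis using top by (simp add: emeasure_restrict_space)
qed

section \<open>Primitives of non-decreasing functions as Young functions\<close>

text \<open>
  The upper limit lives in the extended half-line and enters through an indicator, so that
  \<open>t = \<infinity>\<close> is not a special case and Fubini applies to \<open>primitive a \<circ> h\<close> directly.
\<close>

definition primitive :: "(real \<Rightarrow> ennreal) \<Rightarrow> ennreal \<Rightarrow> ennreal" where
  "primitive a t = (\<integral>\<^sup>+ l. a l * indicator {l. ennreal l < t} l \<partial>half_line)"

lemma measurable_primitive_integrand:
  fixes a :: "real \<Rightarrow> ennreal"
  assumes "a \<in> borel_measurable borel"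
  shows "(\<lambda>l. a l * indicator {l. ennreal l < t} l) \<in> borel_measurable half_line"
proof (rule measurable_half_line_if_borel, rule borel_measurable_times_ennreal[OF assms],
    rule borel_measurable_indicator)
  have "{l \<in> space borel. ennreal l < t} \<in> sets borel" by measurable
  then show "{l. ennreal l < t} \<in> sets borel" by simp
qed

lemma primitive_0 [simp]: "primitive a 0 = 0"
  by (simp add: primitive_def)

lemma primitive_const: "primitive (\<lambda>_. c) t = c * t"
proof -
  have "primitive (\<lambda>_. c) t = (\<integral>\<^sup>+ l. c * indicator {l \<in> space half_line. ennreal l < t} l \<partial>half_line)"
    unfolding primitive_def by (intro nn_integral_cong) (auto simp: indicator_def)
  also have "\<dots> = c * emeasure half_line {l \<in> space half_line. ennreal l < t}"
    by (intro nn_integral_cmult_indicator sets_half_line_Iio)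
  finally show ?thesis unfolding emeasure_half_line_Iio .
qed

lemma primitive_left_continuous:
  assumes "a \<in> borel_measurable borel" "0 < t"
  shows "continuous (at_left t) (primitive a)"
proof -
  have "(primitive a \<longlongrightarrow> primitive a t) (at_left t)"
  proof (rule tendsto_at_left_sequentially[OF assms(2)])
    fix S :: "nat \<Rightarrow> ennreal"
    assume S: "\<And>n. S n < t" "incseq S" "S \<longlonglongrightarrow> t"
    show "(\<lambda>n. primitive a (S n)) \<longlonglongrightarrow> primitive a t"
      unfolding primitive_def
    proof (rule nn_integral_LIMSEQ)
      show "incseq (\<lambda>n l. a l * indicator {l. ennreal l < S n} l)"
        using S(2) by (auto simp: incseq_def le_fun_def indicator_def intro: less_le_trans)
      show "(\<lambda>n. a l * indicator {l. ennreal l < S n} l) \<longlonglongrightarrow> a l * indicator {l. ennreal l < t} l" for l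
      proof (rule tendsto_eventually)
        show "\<forall>\<^sub>F n in sequentially. a l * indicator {l. ennreal l < S n} l = a l * indicator {l. ennreal l < t} l"
        proof (cases "ennreal l < t")
          case True
          with S(3) have "\<forall>\<^sub>F n in sequentially. ennreal l < S n" by (rule order_tendstoD)
          then show ?thesis by eventually_elim (use True in simp)
        next
          case False
          then have "\<not> ennreal l < S n" for n using S(1)[of n] by auto
          then show ?thesis using False by simp
        qed
      qed
    qed (rule measurable_primitive_integrand[OF assms(1)])
  qed
  then show ?thesis
    by (simp add: continuous_within)
qed

text \<open>
  The density at \<open>w\<close> is a slope of the primitive there. Both sides are moved so that no
  subtraction of extended reals occurs; the inequality then already holds between the
  integrands, because \<open>a l \<le> a w\<close> to the left of \<open>w\<close> and \<open>a w \<le> a l\<close> to the right.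
\<close>

lemma primitive_subgradient:
  assumes "mono a" "0 \<le> w"
  shows "primitive a (ennreal w) + a w * x \<le> primitive a x + a w * ennreal w"
proof -
  have a: "a \<in> borel_measurable borel" by (rule borel_measurable_mono_ennreal) fact
  note [measurable] = measurable_primitive_integrand[OF a] measurable_primitive_integrand[of "\<lambda>_. a w"]
  have "primitive a (ennreal w) + a w * x = primitive a (ennreal w) + primitive (\<lambda>_. a w) x"
    by (simp add: primitive_const)
  also have "\<dots> = (\<integral>\<^sup>+ l. a l * indicator {l. ennreal l < ennreal w} l +
      a w * indicator {l. ennreal l < x} l \<partial>half_line)"
    unfolding primitive_def by (intro nn_integral_add[symmetric]) auto
  also have "\<dots> \<le> (\<integral>\<^sup>+ l. a l * indicator {l. ennreal l < x} l +
      a w * indicator {l. ennreal l < ennreal w} l \<partial>half_line)"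
  proof (intro nn_integral_mono)
    fix l assume "l \<in> space half_line"
    then have "0 < l" by (simp add: space_restrict_space)
    then have "l < w \<Longrightarrow> a l \<le> a w" "\<not> l < w \<Longrightarrow> a w \<le> a l" "ennreal l < ennreal w \<longleftrightarrow> l < w"
      using assms by (auto simp: mono_def ennreal_less_iff)
    then show "a l * indicator {l. ennreal l < ennreal w} l + a w * indicator {l. ennreal l < x} l
      \<le> a l * indicator {l. ennreal l < x} l + a w * indicator {l. ennreal l < ennreal w} l"
      by (auto simp: indicator_def add.commute)
  qed
  also have "\<dots> = primitive a x + primitive (\<lambda>_. a w) (ennreal w)"
    unfolding primitive_def by (intro nn_integral_add) auto
  finally show ?thesis by (simp add: primitive_const)
qed

lemma measurable_primitive:
  assumes "a \<in> borel_measurable borel" "h \<in> borel_measurable half_line"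
  shows "(\<lambda>x. primitive a (h x)) \<in> borel_measurable half_line"
proof -
  interpret sigma_finite_measure half_line by (rule sigma_finite_half_line)
  have [measurable]: "a \<in> borel_measurable half_line" "h \<in> borel_measurable half_line"
    "(\<lambda>l. ennreal l) \<in> borel_measurable half_line"
    using assms by (auto intro!: measurable_half_line_if_borel)
  show ?thesis
    unfolding primitive_def
    by (rule borel_measurable_nn_integral) (simp add: case_prod_beta indicator_def)
qed

text \<open>Fubini on the region under the graph of \<open>h\<close>, weighted by \<open>a\<close> in the vertical direction.\<close>

lemma primitive_layer_cake:
  assumes "a \<in> borel_measurable borel" "h \<in> borel_measurable half_line"
  shows "(\<integral>\<^sup>+ x. primitive a (h x) \<partial>half_line) =
    (\<integral>\<^sup>+ l. a l * emeasure half_line {x \<in> space half_line. ennreal l < h x} \<partial>half_line)"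
proof -
  interpret sigma_finite_measure half_line by (rule sigma_finite_half_line)
  interpret P: pair_sigma_finite half_line half_line ..
  have [measurable]: "a \<in> borel_measurable half_line" "h \<in> borel_measurable half_line"
    "(\<lambda>l. ennreal l) \<in> borel_measurable half_line"
    using assms by (auto intro!: measurable_half_line_if_borel)
  have "(\<integral>\<^sup>+ x. primitive a (h x) \<partial>half_line) =
      (\<integral>\<^sup>+ l. \<integral>\<^sup>+ x. a l * indicator {l. ennreal l < h x} l \<partial>half_line \<partial>half_line)"
    unfolding primitive_def
    by (rule P.Fubini'[symmetric]) (simp add: case_prod_beta indicator_def)
  also have "\<dots> = (\<integral>\<^sup>+ l. \<integral>\<^sup>+ x. a l * indicator {x \<in> space half_line. ennreal l < h x} x \<partial>half_line \<partial>half_line)"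
    by (intro nn_integral_cong) (auto simp: indicator_def)
  also have "\<dots> = (\<integral>\<^sup>+ l. a l * emeasure half_line {x \<in> space half_line. ennreal l < h x} \<partial>half_line)"
    by (intro nn_integral_cong nn_integral_cmult_indicator) measurable
  finally show ?thesis .
qed

text \<open>
  Averaging the subgradient inequality at \<open>w = u * s + v * t\<close> over \<open>s\<close> and \<open>t\<close> gives convexity
  once the common term \<open>a w * w\<close> can be cancelled. That needs \<open>a w\<close> finite, so \<open>a\<close> is first
  truncated at height \<open>n\<close>; monotone convergence removes the truncation.
\<close>

lemma primitive_convex:
  assumes "mono a" "u + v = 1" "u * s + v * t < \<infinity>"
  shows "primitive a (u * s + v * t) \<le> u * primitive a s + v * primitive a t"
proof -
  obtain w where w: "u * s + v * t = ennreal w" "0 \<le> w"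
    using assms(3) by (cases "u * s + v * t") auto
  define b where "b n l = min (a l) (of_nat n)" for n l
  have b: "mono (b n)" for n using assms(1) by (auto simp: mono_def b_def intro: min.coboundedI1)
  have le: "primitive (b n) (ennreal w) \<le> u * primitive a s + v * primitive a t" for n
  proof -
    let ?c = "b n w"
    have c: "?c * ennreal w < top" by (auto simp: b_def ennreal_mult_less_top min_less_iff_disj of_nat_less_top)
    have "primitive (b n) (ennreal w) + ?c * ennreal w =
        u * (primitive (b n) (ennreal w) + ?c * s) + v * (primitive (b n) (ennreal w) + ?c * t)"
    proof -
      have "u * (primitive (b n) (ennreal w) + ?c * s) + v * (primitive (b n) (ennreal w) + ?c * t) =
        (u + v) * primitive (b n) (ennreal w) + ?c * (u * s + v * t)" by (simp add: algebra_simps)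
      then show ?thesis using assms(2) w by simp
    qed
    also have "\<dots> \<le> u * (primitive (b n) s + ?c * ennreal w) + v * (primitive (b n) t + ?c * ennreal w)"
      by (intro add_mono mult_left_mono primitive_subgradient b w) auto
    also have "\<dots> = (u * primitive (b n) s + v * primitive (b n) t) + (u + v) * (?c * ennreal w)"
      by (simp add: algebra_simps)
    also have "\<dots> = (u * primitive (b n) s + v * primitive (b n) t) + ?c * ennreal w"
      using assms(2) by simp
    finally have "primitive (b n) (ennreal w) \<le> u * primitive (b n) s + v * primitive (b n) t"
      using c[THEN less_imp_neq]
      by (simp add: ennreal_add_left_cancel_le add.commute[of _ "?c * ennreal w"])
    also have "\<dots> \<le> u * primitive a s + v * primitive a t"
      unfolding primitive_def
      by (intro add_mono mult_left_mono nn_integral_mono mult_right_mono) (auto simp: b_def)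
    finally show ?thesis .
  qed
  have "(\<lambda>n. primitive (b n) (ennreal w)) \<longlonglongrightarrow> primitive a (ennreal w)"
    unfolding primitive_def
  proof (rule nn_integral_LIMSEQ)
    show "incseq (\<lambda>n l. b n l * indicator {l. ennreal l < ennreal w} l)"
      by (auto simp: incseq_def le_fun_def b_def intro!: mult_right_mono min.mono)
    show "(\<lambda>n. b n l * indicator {l. ennreal l < ennreal w} l) \<longlonglongrightarrow>
        a l * indicator {l. ennreal l < ennreal w} l" for l
    proof -
      have "(\<lambda>n. b n l) \<longlonglongrightarrow> min (a l) top"
        unfolding b_def by (intro tendsto_min tendsto_const of_nat_tendsto_top_ennreal)
      then show ?thesis by (auto simp: indicator_def)
    qed
  qed (intro measurable_primitive_integrand borel_measurable_mono_ennreal b)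
  then show ?thesis unfolding w(1) by (rule LIMSEQ_le_const2) (use le in blast)
qed

text \<open>
  The subgradient at \<open>d\<close> forces linear growth. Truncating at \<open>1\<close> makes the slope at \<open>d\<close>
  finite, and hence the term \<open>b d * d\<close> on the right-hand side as well.
\<close>

lemma primitive_top:
  assumes "mono a" "0 < d" "a d \<noteq> 0"
  shows "primitive a top = top"
proof -
  define b where "b l = min (a l) 1" for l
  have "mono b" using assms(1) by (auto simp: mono_def b_def intro: min.coboundedI1)
  then have "primitive b (ennreal d) + b d * top \<le> primitive b top + b d * ennreal d"
    using assms(2) by (intro primitive_subgradient) auto
  moreover have "b d \<noteq> 0" "b d \<le> 1" using assms(3) by (auto simp: b_def min_def)
  moreover have "b d * ennreal d < top"
    using \<open>b d \<le> 1\<close> by (auto simp: ennreal_mult_less_top intro: le_less_trans)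
  ultimately have "primitive b top = top"
    by (auto simp: ennreal_mult_top top_unique)
  moreover have "primitive b top \<le> primitive a top"
    unfolding primitive_def by (intro nn_integral_mono mult_right_mono) (auto simp: b_def)
  ultimately show ?thesis by (simp add: top_unique)
qed

text \<open>
  The two conditions on the density are what keeps the primitive from being identically \<open>\<infinity>\<close> or
  identically \<open>0\<close>. In the convexity inequality the point \<open>u * s + v * t\<close> may be infinite; then a
  summand with positive weight is infinite, and the right-hand side is infinite as well. The
  monotonicity of \<open>A(t)/t\<close> is convexity with \<open>0\<close> as one of the two points.
\<close>

lemma young_function_primitive:
  assumes "mono a" "0 < c" "a c < \<infinity>" "0 < d" "a d \<noteq> 0"
  shows "young_function (primitive a)"
proof -
  note top = primitive_top[OF assms(1,4,5)]
  have convex: "primitive a (u * s + v * t) \<le> u * primitive a s + v * primitive a t"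
    if "u + v = 1" for u v s t
  proof (cases "u * s + v * t < \<infinity>")
    case False
    then have "u * s = top \<or> v * t = top" by (auto simp: less_top[symmetric])
    moreover have "u \<noteq> top" "v \<noteq> top" using that by auto
    ultimately have "u \<noteq> 0 \<and> s = top \<or> v \<noteq> 0 \<and> t = top" by (auto simp: ennreal_mult_eq_top_iff)
    then show ?thesis by (auto simp: top ennreal_mult_top)
  qed (use primitive_convex[OF assms(1) that] in blast)
  have "mono_on {0<..<\<infinity>} (\<lambda>t. primitive a t / t)"
  proof (rule mono_onI)
    fix s t :: ennreal assume st: "s \<in> {0<..<\<infinity>}" "t \<in> {0<..<\<infinity>}" "s \<le> t"
    obtain x y where xy: "s = ennreal x" "t = ennreal y" "0 < x" "x \<le> y"
      using st by (cases s; cases t) (auto simp: ennreal_less_iff)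
    have "primitive a (ennreal (x / y) * t + ennreal (1 - x / y) * 0) \<le>
        ennreal (x / y) * primitive a t + ennreal (1 - x / y) * primitive a 0"
      using xy by (intro convex) (auto simp: ennreal_plus[symmetric] simp del: ennreal_plus)
    moreover have "ennreal (x / y) * t = s" using xy by (simp add: ennreal_mult[symmetric])
    ultimately have "primitive a s \<le> ennreal (x / y) * primitive a t" by simp
    then have "primitive a s / s \<le> ennreal (x / y) * primitive a t / s"
      by (rule divide_right_mono_ennreal)
    also have "\<dots> = primitive a t / t"
      using xy by (cases "primitive a t") (auto simp: divide_ennreal ennreal_mult[symmetric] ennreal_mult_top ennreal_top_divide)
    finally show "primitive a s / s \<le> primitive a t / t" .
  qed
  moreover have "primitive a (ennreal c) \<noteq> \<infinity>"
  proof -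
    have "primitive a (ennreal c) \<le> a c * ennreal c"
      using primitive_subgradient[OF assms(1), of c 0] assms(2) by simp
    also have "\<dots> < \<infinity>" using assms(3) by (simp add: ennreal_mult_less_top)
    finally show ?thesis by simp
  qed
  moreover have "\<exists>t>0. primitive a t \<noteq> 0" by (rule exI[of _ top]) (simp add: top)
  ultimately have "quasi_convex (primitive a)"
    unfolding quasi_convex_def
    using primitive_left_continuous[OF borel_measurable_mono_ennreal[OF assms(1)]] assms(2)
    by (auto intro!: exI[of _ "ennreal c"])
  then show ?thesis
    unfolding young_function_def using convex by blast
qed

section \<open>The fundamental function of a quasi-convex function\<close>

lemma ennreal_times_divide_cancel:
  fixes x y :: ennreal
  shows "y \<noteq> 0 \<Longrightarrow> y \<noteq> top \<Longrightarrow> y * (x / y) = x"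
  unfolding ennreal_times_divide mult.commute[of y x] by (rule mult_divide_eq_ennreal)

lemma quasi_convex_scale:
  assumes "quasi_convex E" "0 \<le> x" "x \<le> y" "0 < y"
  shows "E (ennreal x) \<le> ennreal (x / y) * E (ennreal y)"
proof (cases "x = 0")
  case False
  have "E (ennreal x) / ennreal x \<le> E (ennreal y) / ennreal y"
    using assms False by (auto simp: quasi_convex_def intro!: mono_onD[of _ "\<lambda>t. E t / t"])
  then have "ennreal x * (E (ennreal x) / ennreal x) \<le> ennreal x * (E (ennreal y) / ennreal y)"
    by (rule mult_left_mono) simp
  moreover have "ennreal x * (E (ennreal x) / ennreal x) = E (ennreal x)"
    using False assms by (simp add: ennreal_times_divide_cancel)
  moreover have "ennreal x * (E (ennreal y) / ennreal y) = ennreal (x / y) * E (ennreal y)"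
    using assms by (cases "E (ennreal y)") (auto simp: divide_ennreal ennreal_mult[symmetric] ennreal_mult_top ennreal_top_divide)
  ultimately show ?thesis by simp
qed (use assms in \<open>simp add: quasi_convex_def\<close>)

lemma quasi_convex_tendsto_top:
  assumes "quasi_convex E"
  shows "(E \<longlongrightarrow> E top) (at_left top)"
  using assms by (simp add: quasi_convex_def continuous_within)

text \<open>
  Monotonicity of \<open>E(s)/s\<close> only speaks about finite \<open>s\<close>, whereas \<open>E\<close> is only known to be nonzero
  somewhere on \<open>(0,\<infinity>]\<close>. Left-continuity at \<open>\<infinity>\<close> bridges both gaps: it excludes that \<open>E\<close>
  vanishes on all finite arguments, and it extends the linear bound to \<open>s = \<infinity>\<close>.
\<close>

lemma quasi_convex_linear_lower_bound:
  assumes "quasi_convex E"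
  obtains t k where "0 < t" "0 < k" "\<And>s. ennreal t \<le> s \<Longrightarrow> k * s \<le> E s"
proof -
  note lim = quasi_convex_tendsto_top[OF assms]
  have nt: "at_left (top::ennreal) \<noteq> bot"
  proof
    assume "at_left (top::ennreal) = bot"
    then have "eventually (\<lambda>_. False) (at_left (top::ennreal))" by simp
    then obtain b :: ennreal where b: "b < top" "\<And>y. b < y \<Longrightarrow> y < top \<Longrightarrow> False"
      unfolding eventually_at_left[of 0 top, OF ennreal_zero_less_top] by blast
    with dense[OF b(1)] show False by blast
  qed
  have "\<exists>t>0. E (ennreal t) \<noteq> 0"
  proof (rule ccontr)
    assume "\<not> ?thesis"
    then have pos: "E (ennreal t) = 0" if "0 < t" for t using that by blast
    have zero: "E s = 0" if "s < top" for s
    proof (cases s)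
      case (real t)
      then show ?thesis using pos[of t] assms by (cases "t = 0") (simp_all add: quasi_convex_def)
    qed (use that in simp)
    then have "eventually (\<lambda>s. E s = 0) (at_left top)"
      unfolding eventually_at_filter by simp
    then have "((\<lambda>_. 0) \<longlongrightarrow> E top) (at_left (top :: ennreal))"
      by (rule Lim_transform_eventually[OF lim])
    then have "E top = 0" by (rule tendsto_unique[OF nt _ tendsto_const])
    then have "E s = 0" for s using zero[of s] by (cases "s = top") (simp_all add: less_top[symmetric])
    then show False using assms by (auto simp: quasi_convex_def)
  qed
  then obtain t where t: "0 < t" "E (ennreal t) \<noteq> 0" by blast
  (* The minimum makes k finite, so that multiplication by k is continuous at \<infinity>. *)
  define k where "k = min 1 (E (ennreal t) / ennreal t)"
  have fin: "k * s \<le> E s" if "ennreal t \<le> s" "s < top" for s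
  proof -
    have "E (ennreal t) / ennreal t \<le> E s / s"
    proof (rule mono_onD[of "{0<..<\<infinity>}" "\<lambda>t. E t / t"])
      show "mono_on {0<..<\<infinity>} (\<lambda>t. E t / t)" using assms by (simp add: quasi_convex_def)
      show "s \<in> {0<..<\<infinity>}" using that t less_le_trans[of 0 "ennreal t" s] by simp
    qed (use that t in auto)
    then have "k * s \<le> E s / s * s"
      unfolding k_def by (intro mult_right_mono min.coboundedI2) simp_all
    also have "s \<noteq> 0" using that t by auto
    then have "E s / s * s = E s"
      using that ennreal_times_divide_cancel[of s "E s"] by (simp add: mult.commute)
    finally show ?thesis .
  qed
  have k: "k > 0" using t by (simp add: k_def ennreal_zero_less_divide zero_less_iff_neq_zero)
  have "k * top \<le> E top"
  proof (rule tendsto_le[OF nt lim])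
    show "((\<lambda>s. k * s) \<longlongrightarrow> k * top) (at_left top)"
    proof (rule ennreal_tendsto_cmult[OF _ tendsto_ident_at])
      have "k \<le> 1" by (simp add: k_def)
      also have "(1::ennreal) < top" by simp
      finally show "k < top" .
    qed
    have "eventually (\<lambda>s. s \<in> {ennreal t<..<top}) (at_left (top::ennreal))"
      by (rule eventually_at_leftI[of "ennreal t"]) auto
    then show "\<forall>\<^sub>F s in at_left top. k * s \<le> E s" by eventually_elim (auto intro: fin)
  qed
  then have "k * s \<le> E s" if "ennreal t \<le> s" for s
    using fin[OF that] that by (cases "s = top") (simp_all add: less_top[symmetric])
  with t k show ?thesis using that by blast
qed

lemma divide_left_mono_ennreal:
  fixes a b c :: ennreal
  shows "a \<le> b \<Longrightarrow> c / b \<le> c / a"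
proof -
  assume "a \<le> b"
  then have "inverse b \<le> inverse a"
    by (cases a; cases b; cases "a = 0") (auto simp: inverse_ennreal less_le top_unique)
  then show ?thesis unfolding divide_ennreal_def by (rule mult_left_mono) simp
qed

lemma right_inverse_mono: "s \<le> t \<Longrightarrow> right_inverse A s \<le> right_inverse A t"
  unfolding right_inverse_def by (intro Sup_subset_mono) auto

lemma right_inverse_less_top:
  assumes "quasi_convex E" "u < \<infinity>"
  shows "right_inverse E u < \<infinity>"
proof -
  obtain t k where tk: "0 < t" "0 < k" "\<And>s. ennreal t \<le> s \<Longrightarrow> k * s \<le> E s"
    using quasi_convex_linear_lower_bound[OF assms(1)] by metis
  have "right_inverse E u \<le> max (ennreal t) (u / k)"
    unfolding right_inverse_def
  proof (rule Sup_least)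
    fix s assume "s \<in> {\<tau>. E \<tau> \<le> u}"
    then have "ennreal t \<le> s \<Longrightarrow> k * s \<le> u" using tk(3) order_trans by blast
    moreover have "s \<le> u / k" if "k * s \<le> u"
      using that assms(2) tk(1,2)
      by (cases s; cases k; cases u) (auto simp: ennreal_mult[symmetric] divide_ennreal field_simps ennreal_mult_top ennreal_top_mult top_unique split: if_splits)
    ultimately show "s \<le> max (ennreal t) (u / k)" by (metis le_max_iff_disj linear)
  qed
  also have "\<dots> < \<infinity>" using assms(2) tk(2)
    by (auto simp: ennreal_divide_eq_top_iff less_top[symmetric] max_def)
  finally show ?thesis .
qed

lemma inverse_sharp_mono: "s \<le> t \<Longrightarrow> inverse_sharp E s \<le> inverse_sharp E t"
  unfolding inverse_sharp_def by (intro divide_left_mono_ennreal right_inverse_mono)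

lemma inverse_sharp_pos:
  assumes "quasi_convex E" "0 < s"
  shows "0 < inverse_sharp E s"
proof -
  have "1 / s < \<infinity>"
    using assms(2) by (simp add: ennreal_divide_eq_top_iff less_top[symmetric])
  from right_inverse_less_top[OF assms(1) this] show ?thesis
    by (simp add: inverse_sharp_def ennreal_zero_less_divide)
qed

text \<open>
  A short interval has an indicator function of finite Lorentz norm: a value \<open>E t < \<infinity>\<close> with
  \<open>t > 0\<close> bounds \<open>E\<^sup>-\<^sup>1(1/r)\<close> from below by \<open>t\<close> as soon as \<open>1/r \<ge> E t\<close>.
\<close>

lemma inverse_sharp_finite_somewhere:
  assumes "quasi_convex E"
  obtains r where "0 < r" "inverse_sharp E (ennreal r) < \<infinity>"
proof -
  obtain t where t: "t > 0" "E t \<noteq> \<infinity>" using assms by (auto simp: quasi_convex_def)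
  then obtain e where e: "E t = ennreal e" "0 \<le> e" by (cases "E t") auto
  (* The summand 1 covers the case E t = 0. *)
  define r where "r = 1 / (e + 1)"
  have r: "r > 0" using e by (simp add: r_def)
  have "1 / ennreal r = ennreal (e + 1)" using e r by (simp add: r_def divide_ennreal flip: ennreal_1)
  then have "E t \<le> 1 / ennreal r" using e by (simp add: ennreal_leI)
  then have "t \<le> right_inverse E (1 / ennreal r)" unfolding right_inverse_def by (auto intro: Sup_upper)
  then have "right_inverse E (1 / ennreal r) \<noteq> 0" using t by auto
  then have "inverse_sharp E (ennreal r) < \<infinity>" 
    by (simp add: inverse_sharp_def ennreal_divide_eq_top_iff less_top[symmetric])
  with r show ?thesis using that by blast
qed

text \<open>
  With \<open>\<Phi>\<close> for \<open>inverse_sharp E\<close>, this is \<open>\<Phi>(r)/r\<close>. As \<open>\<Phi>(0) = 0\<close>, the quotient at \<open>r = 0\<close>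
  would be \<open>0/0 = 0\<close>; the value \<open>\<infinity>\<close> there keeps the slope non-increasing, and makes the Young
  function built from it \<open>\<infinity>\<close> beyond the point where the distribution function becomes \<open>0\<close>.
  At \<open>r = \<infinity>\<close> the slope is \<open>0\<close>.
\<close>

definition sharp_slope :: "(ennreal \<Rightarrow> ennreal) \<Rightarrow> ennreal \<Rightarrow> ennreal" where
  "sharp_slope E r = (if r = 0 then \<infinity> else inverse_sharp E r / r)"

text \<open>
  Quasi-concavity of \<open>\<Phi>\<close> is the dual of quasi-convexity of \<open>E\<close>. For finite \<open>0 < x \<le> y\<close> the
  claim says \<open>E\<^sup>-\<^sup>1(1/x) \<le> (y/x) E\<^sup>-\<^sup>1(1/y)\<close>: if \<open>E z \<le> 1/x\<close>, then shrinking the argument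
  by the factor \<open>x/y \<le> 1\<close> shrinks the value at least as much, so \<open>E((x/y) z) \<le> 1/y\<close>.
\<close>

lemma sharp_slope_antimono:
  assumes "quasi_convex E" "r \<le> s"
  shows "sharp_slope E s \<le> sharp_slope E r"
proof (cases "r = 0 \<or> s = top")
  case False
  then obtain x y where xy: "r = ennreal x" "s = ennreal y" "0 < x" "x \<le> y"
    using assms(2) by (cases r; cases s) (auto simp: less_le top_unique)
  let ?R = "right_inverse E"
  have "?R (1 / r) \<le> ennreal (y / x) * ?R (1 / s)"
    unfolding right_inverse_def[of _ "1 / r"]
  proof (rule Sup_least)
    fix t assume "t \<in> {\<tau>. E \<tau> \<le> 1 / r}"
    then have t: "E t \<le> 1 / r" by simp
    then have "t \<le> ?R (1 / r)" unfolding right_inverse_def by (auto intro: Sup_upper)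
    also have "\<dots> < \<infinity>" using xy by (intro right_inverse_less_top assms) (simp add: divide_ennreal flip: ennreal_1)
    finally obtain z where z: "t = ennreal z" "0 \<le> z" by (cases t) auto
    have "ennreal (x / y * z) \<le> ?R (1 / s)"
      unfolding right_inverse_def
    proof (intro Sup_upper CollectI)
      show "E (ennreal (x / y * z)) \<le> 1 / s"
      proof (cases "z = 0")
        case True
        then show ?thesis using assms(1) by (simp add: quasi_convex_def)
      next
        case False
        have "x / y * z \<le> z" using xy z by (intro mult_left_le_one_le) auto
        then have "E (ennreal (x / y * z)) \<le> ennreal (x / y * z / z) * E (ennreal z)"
          using xy z False by (intro quasi_convex_scale assms(1)) auto
        also have "\<dots> \<le> ennreal (x / y) * (1 / r)"
          using t z False by (intro mult_mono) auto
        also have "\<dots> = 1 / s"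
          using xy by (simp add: divide_ennreal ennreal_mult[symmetric] flip: ennreal_1)
        finally show ?thesis .
      qed
    qed
    then have "ennreal (y / x) * ennreal (x / y * z) \<le> ennreal (y / x) * ?R (1 / s)"
      by (rule mult_left_mono) simp
    then show "t \<le> ennreal (y / x) * ?R (1 / s)"
      using xy z by (simp add: ennreal_mult[symmetric])
  qed
  then have "1 / (ennreal (y / x) * ?R (1 / s)) / r \<le> 1 / ?R (1 / r) / r"
    by (intro divide_right_mono_ennreal divide_left_mono_ennreal)
  moreover have "1 / (ennreal (y / x) * ?R (1 / s)) / r = 1 / ?R (1 / s) / s"
    using xy by (cases "?R (1 / s)"; cases "?R (1 / s) = 0")
      (auto simp: divide_ennreal ennreal_mult[symmetric] ennreal_mult_top ennreal_top_divide
        simp flip: ennreal_1)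
  ultimately show ?thesis
    using False assms(2) by (auto simp: sharp_slope_def inverse_sharp_def)
qed (auto simp: sharp_slope_def)

lemma times_sharp_slope_le: "r * sharp_slope E r \<le> inverse_sharp E r"
  by (cases "r = 0 \<or> r = top")
    (auto simp: sharp_slope_def ennreal_times_divide_cancel)

text \<open>
  The inequality on which everything rests. For \<open>s \<le> r\<close> the first summand suffices, by
  monotonicity of \<open>\<Phi>\<close>; for \<open>s > r\<close> the second one does, because the slope is non-increasing.
\<close>

lemma inverse_sharp_le_tangent:
  assumes "quasi_convex E"
  shows "inverse_sharp E s \<le> inverse_sharp E r + s * sharp_slope E r"
proof (cases "s \<le> r")
  case True
  then show ?thesis using inverse_sharp_mono[OF True, of E] by (simp add: add_increasing2)
next
  case False
  then have rs: "r < s" by simp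
  have "inverse_sharp E s \<le> s * sharp_slope E r"
  proof (cases "s = top")
    case True
    then have "0 < sharp_slope E r"
      using rs inverse_sharp_pos[OF assms, of r]
      by (auto simp: sharp_slope_def ennreal_zero_less_divide zero_less_iff_neq_zero)
    then show ?thesis using True by (simp add: ennreal_top_mult)
  next
    case False
    then have "inverse_sharp E s = s * sharp_slope E s"
      using rs by (auto simp: sharp_slope_def ennreal_times_divide_cancel)
    also have "\<dots> \<le> s * sharp_slope E r"
      using rs by (intro mult_left_mono sharp_slope_antimono assms) auto
    finally show ?thesis .
  qed
  then show ?thesis by (simp add: add_increasing)
qed

section \<open>The Young function generated by a distribution function\<close>

lemma distribution_fun_antimono: "antimono (distribution_fun f)" if "f \<in> borel_measurable half_line"
proof (rule antimonoI)
  fix k l :: real assume "k \<le> l"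
  have [measurable]: "f \<in> borel_measurable half_line" by fact
  show "distribution_fun f l \<le> distribution_fun f k"
    unfolding distribution_fun_def
  proof (rule emeasure_mono)
    show "{x \<in> space half_line. ereal k < \<bar>f x\<bar>} \<in> sets half_line" by measurable
  qed (use \<open>k \<le> l\<close> in \<open>auto intro: le_less_trans[of "ereal k" "ereal l"]\<close>)
qed

lemma less_absval_divide_iff:
  assumes "0 < c" "0 \<le> l"
  shows "ennreal l < absval f x / ennreal c \<longleftrightarrow> ereal (c * l) < \<bar>f x\<bar>"
  using assms by (cases "f x") (auto simp: divide_ennreal ennreal_less_iff field_simps ennreal_top_divide)

text \<open>
  The dilation is put on the distribution function, since it is the Lorentz norm that can
  then be matched by a change of variables.
\<close>

lemma nn_integral_primitive_divide:
  assumes "f \<in> borel_measurable half_line" "a \<in> borel_measurable borel" "0 < c"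
  shows "(\<integral>\<^sup>+ x. primitive a (absval f x / ennreal c) \<partial>half_line) =
    (\<integral>\<^sup>+ l. a l * distribution_fun f (c * l) \<partial>half_line)"
proof -
  have [measurable]: "f \<in> borel_measurable half_line" by fact
  have "(\<integral>\<^sup>+ x. primitive a (absval f x / ennreal c) \<partial>half_line) =
      (\<integral>\<^sup>+ l. a l * emeasure half_line {x \<in> space half_line. ennreal l < absval f x / ennreal c} \<partial>half_line)"
  proof (rule primitive_layer_cake[OF assms(2)])
    show "(\<lambda>x. absval f x / ennreal c) \<in> borel_measurable half_line" by measurable
  qed
  also have "\<dots> = (\<integral>\<^sup>+ l. a l * distribution_fun f (c * l) \<partial>half_line)"
    unfolding distribution_fun_def
  proof (intro nn_integral_cong)
    fix l assume "l \<in> space half_line"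
    then have "0 \<le> l" by (simp add: space_restrict_space)
    then show "a l * emeasure half_line {x \<in> space half_line. ennreal l < absval f x / ennreal c} =
      a l * emeasure half_line {x \<in> space half_line. ereal (c * l) < \<bar>f x\<bar>}"
      using less_absval_divide_iff[OF assms(3)] by simp
  qed
  finally show ?thesis .
qed

text \<open>
  If \<open>A(|g|/c)\<close> has integral at most \<open>1\<close>, the tangent inequality applied to \<open>g\<^sub>*(c \<lambda>)\<close> at
  \<open>m(\<lambda>)\<close> integrates to \<open>K + 1\<close>, and substituting \<open>c \<lambda>\<close> for \<open>\<lambda>\<close> in the Lorentz norm of \<open>g\<close>
  contributes the factor \<open>c\<close>. The infimum over \<open>c\<close> is the Orlicz norm.
\<close>

lemma embeds_primitive_sharp_slope:
  assumes "quasi_convex E" "antimono m"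
    and fin: "(\<integral>\<^sup>+ l. inverse_sharp E (m l) \<partial>half_line) < \<infinity>"
  defines "A \<equiv> primitive (\<lambda>l. sharp_slope E (m l))"
  shows "embeds (orlicz_norm A) (lorentz_norm E)"
proof -
  define a where "a l = sharp_slope E (m l)" for l
  define K where "K = (\<integral>\<^sup>+ l. inverse_sharp E (m l) \<partial>half_line)"
  obtain k where k: "K = ennreal k" "0 \<le> k" using fin by (cases K) (auto simp: K_def)
  have "mono a" using assms by (auto simp: mono_def antimono_def a_def intro: sharp_slope_antimono)
  then have a: "a \<in> borel_measurable borel" by (rule borel_measurable_mono_ennreal)
  have phi_m: "(\<lambda>l. inverse_sharp E (m l)) \<in> borel_measurable borel"
    using assms by (intro borel_measurable_antimono_ennreal) (auto simp: antimono_def intro: inverse_sharp_mono)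
  have bound: "lorentz_norm E g \<le> ennreal c * (K + 1)"
    if g: "g \<in> borel_measurable half_line" and c: "0 < c"
      and le: "(\<integral>\<^sup>+ x. A (absval g x / ennreal c) \<partial>half_line) \<le> 1" for g c
  proof -
    note anti = distribution_fun_antimono[OF g]
    have dist: "(\<lambda>l. distribution_fun g (c * l)) \<in> borel_measurable borel"
      using anti c by (intro borel_measurable_antimono_ennreal) (auto simp: antimono_def)
    note [measurable] = measurable_half_line_if_borel[OF a] measurable_half_line_if_borel[OF phi_m]
      measurable_half_line_if_borel[OF dist]
    have "lorentz_norm E g = ennreal c * (\<integral>\<^sup>+ l. inverse_sharp E (distribution_fun g (c * l)) \<partial>half_line)"
      unfolding lorentz_norm_def using anti c
      by (intro nn_integral_half_line_scale borel_measurable_antimono_ennreal)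
        (auto simp: antimono_def intro: inverse_sharp_mono)
    also have "\<dots> \<le> ennreal c *
        (\<integral>\<^sup>+ l. inverse_sharp E (m l) + a l * distribution_fun g (c * l) \<partial>half_line)"
      unfolding a_def mult.commute[of "sharp_slope _ _"]
      by (intro mult_left_mono nn_integral_mono inverse_sharp_le_tangent assms) auto
    also have "(\<integral>\<^sup>+ l. inverse_sharp E (m l) + a l * distribution_fun g (c * l) \<partial>half_line) =
        K + (\<integral>\<^sup>+ x. A (absval g x / ennreal c) \<partial>half_line)"
      using nn_integral_primitive_divide[OF g a c]
      unfolding A_def K_def a_def[symmetric] by (subst nn_integral_add) auto
    also have "ennreal c * (K + (\<integral>\<^sup>+ x. A (absval g x / ennreal c) \<partial>half_line)) \<le> ennreal c * (K + 1)"
      using le by (intro mult_left_mono add_left_mono) auto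
    finally show ?thesis .
  qed
  have K1: "K + 1 = ennreal (k + 1)" "0 < K + 1" "K + 1 \<noteq> top" using k by (auto simp: add_pos_nonneg add.commute)
  show ?thesis
    unfolding embeds_def
  proof (intro exI[of _ "k + 1"] conjI ballI)
    fix g assume "g \<in> fun_space (orlicz_norm A)"
    then have g: "g \<in> borel_measurable half_line" by (simp add: fun_space_def)
    have "lorentz_norm E g / (K + 1) \<le> orlicz_norm A g"
      unfolding orlicz_norm_def
    proof (rule Inf_greatest, clarify)
      fix l assume l: "0 < l" "l < \<infinity>" "(\<integral>\<^sup>+ x. A (absval g x / l) \<partial>half_line) \<le> 1"
      then obtain c where c: "l = ennreal c" "0 < c" by (cases l) auto
      show "lorentz_norm E g / (K + 1) \<le> l"
        using bound[OF g c(2)] l(3) K1(2) c(1) by (intro divide_le_posI_ennreal) (auto simp: mult.commute)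
    qed
    then have "lorentz_norm E g / (K + 1) * (K + 1) \<le> orlicz_norm A g * (K + 1)"
      by (rule mult_right_mono) simp
    moreover have "lorentz_norm E g / (K + 1) * (K + 1) = lorentz_norm E g"
      using K1(2,3) ennreal_times_divide_cancel[of "K + 1" "lorentz_norm E g"]
      by (simp add: mult.commute)
    ultimately show "lorentz_norm E g \<le> ennreal (k + 1) * orlicz_norm A g"
      by (simp only: K1(1) mult.commute)
  qed (use k in simp)
qed

text \<open>
  By convexity and \<open>A(0) = 0\<close>, dividing the argument by \<open>c \<ge> 1\<close> divides the integral by at
  least \<open>c\<close>; so any \<open>c \<ge> 1\<close> exceeding the integral is admissible in the Orlicz norm.
\<close>

lemma orlicz_space_if_integrable:
  assumes "young_function A" "f \<in> borel_measurable half_line"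
    and "(\<lambda>x. A (absval f x)) \<in> borel_measurable half_line"
    and "(\<integral>\<^sup>+ x. A (absval f x) \<partial>half_line) < \<infinity>"
  shows "f \<in> orlicz_space A"
proof -
  note [measurable] = assms(3)
  define K where "K = (\<integral>\<^sup>+ x. A (absval f x) \<partial>half_line)"
  obtain k where k: "K = ennreal k" "0 \<le> k" using assms(4) by (cases K) (auto simp: K_def)
  define c where "c = k + 1"
  have c: "0 < c" "1 \<le> c" "k \<le> c" using k by (auto simp: c_def)
  have scale: "A (t / ennreal c) \<le> ennreal (1 / c) * A t" for t
  proof -
    have "A (ennreal (1 / c) * t + ennreal (1 - 1 / c) * 0) \<le>
        ennreal (1 / c) * A t + ennreal (1 - 1 / c) * A 0"
    proof -
      have "ennreal (1 / c) + ennreal (1 - 1 / c) = 1"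
        using c by (simp add: ennreal_plus[symmetric] del: ennreal_plus)
      then show ?thesis using assms(1) unfolding young_function_def by blast
    qed
    moreover have "A 0 = 0" using assms(1) by (simp add: young_function_def quasi_convex_def)
    moreover have "ennreal (1 / c) * t = t / ennreal c"
      using c by (simp add: divide_ennreal_def inverse_ennreal field_simps)
    ultimately show ?thesis by simp
  qed
  have "(\<integral>\<^sup>+ x. A (absval f x / ennreal c) \<partial>half_line) \<le>
      (\<integral>\<^sup>+ x. ennreal (1 / c) * A (absval f x) \<partial>half_line)"
    by (intro nn_integral_mono scale)
  also have "\<dots> = ennreal (1 / c) * ennreal k"
    using k by (simp add: nn_integral_cmult K_def)
  also have "\<dots> \<le> 1" using c k by (simp add: ennreal_mult[symmetric])
  finally have "orlicz_norm A f \<le> ennreal c"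
    unfolding orlicz_norm_def using c by (intro Inf_lower) auto
  then show ?thesis
    using assms(2) by (auto simp: orlicz_space_def fun_space_def intro: le_less_trans)
qed

theorem theorem2p7:
  fixes E :: "ennreal \<Rightarrow> ennreal"
  assumes "quasi_convex E"
  shows "lorentz_space E =
    \<Union> {orlicz_space A | A. young_function A \<and> embeds (orlicz_norm A) (lorentz_norm E)}"
proof (intro subset_antisym subsetI)
  fix f assume "f \<in> \<Union> {orlicz_space A | A. young_function A \<and> embeds (orlicz_norm A) (lorentz_norm E)}"
  then obtain A where f: "f \<in> fun_space (orlicz_norm A)" and A: "embeds (orlicz_norm A) (lorentz_norm E)"
    by (auto simp: orlicz_space_def)
  from A f obtain C where "lorentz_norm E f \<le> ennreal C * orlicz_norm A f"
    unfolding embeds_def by blast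
  also have "\<dots> < \<infinity>" using f by (simp add: fun_space_def ennreal_mult_less_top)
  finally show "f \<in> lorentz_space E" using f by (simp add: fun_space_def lorentz_space_def)
next
  fix f assume "f \<in> lorentz_space E"
  then have f: "f \<in> borel_measurable half_line" "lorentz_norm E f < \<infinity>"
    by (auto simp: lorentz_space_def fun_space_def)
  obtain r where r: "0 < r" "inverse_sharp E (ennreal r) < \<infinity>"
    using inverse_sharp_finite_somewhere[OF assms] .
  define m where "m l = max (distribution_fun f l) (if l < 1 then ennreal r else 0)" for l :: real
  define a where "a l = sharp_slope E (m l)" for l
  have m: "antimono m"
    unfolding antimono_def m_def
    using antimonoD[OF distribution_fun_antimono[OF f(1)]] by (intro allI impI max.mono) auto
  then have a: "mono a" using assms by (auto simp: mono_def antimono_def a_def intro: sharp_slope_antimono)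
  note a_borel = borel_measurable_mono_ennreal[OF a]

  have "(\<integral>\<^sup>+ l. inverse_sharp E (m l) \<partial>half_line) \<le>
     (\<integral>\<^sup>+ l. inverse_sharp E (distribution_fun f l) +
       inverse_sharp E (ennreal r) * indicator {l \<in> space half_line. ennreal l < 1} l \<partial>half_line)"
    by (intro nn_integral_mono) (auto simp: m_def max_def indicator_def space_restrict_space
        ennreal_less_one_iff add_increasing add_increasing2)
  also have "\<dots> = lorentz_norm E f + inverse_sharp E (ennreal r) * emeasure half_line {l \<in> space half_line. ennreal l < 1}"
  proof -
    have [measurable]: "(\<lambda>l. inverse_sharp E (distribution_fun f l)) \<in> borel_measurable half_line"
      using distribution_fun_antimono[OF f(1)]
      by (intro measurable_half_line_if_borel borel_measurable_antimono_ennreal)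
        (auto simp: antimono_def intro: inverse_sharp_mono)
    let ?S = "{l \<in> space half_line. ennreal l < 1}"
    have "(\<integral>\<^sup>+ l. inverse_sharp E (distribution_fun f l) +
        inverse_sharp E (ennreal r) * indicator ?S l \<partial>half_line) =
      lorentz_norm E f + (\<integral>\<^sup>+ l. inverse_sharp E (ennreal r) * indicator ?S l \<partial>half_line)"
      unfolding lorentz_norm_def
      by (intro nn_integral_add borel_measurable_times_ennreal borel_measurable_indicator
          sets_half_line_Iio) (auto)
    also have "(\<integral>\<^sup>+ l. inverse_sharp E (ennreal r) * indicator ?S l \<partial>half_line) =
        inverse_sharp E (ennreal r) * emeasure half_line ?S"
      by (intro nn_integral_cmult_indicator sets_half_line_Iio)
    finally show ?thesis .
  qed
  also have "\<dots> < \<infinity>"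
    unfolding emeasure_half_line_Iio using f r by simp
  finally have fin: "(\<integral>\<^sup>+ l. inverse_sharp E (m l) \<partial>half_line) < \<infinity>" .

  (* A slope vanishes only at r = \<infinity>, and m cannot be \<infinity> throughout, as \<Phi>(m) would then be
     a positive constant on a set of infinite measure. *)
  have "\<exists>d>0. a d \<noteq> 0"
  proof (rule ccontr)
    assume "\<not> ?thesis"
    then have "m l = top" if "0 < l" for l
      using that inverse_sharp_pos[OF assms, of "m l"]
      by (auto simp: a_def sharp_slope_def zero_less_iff_neq_zero split: if_splits)
    then have "(\<integral>\<^sup>+ l. inverse_sharp E (m l) \<partial>half_line) = (\<integral>\<^sup>+ l. inverse_sharp E top \<partial>half_line)"
      by (intro nn_integral_cong) (auto simp: space_restrict_space)
    also have "\<dots> = inverse_sharp E top * emeasure half_line (space half_line)" by simp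
    also have "emeasure half_line (space half_line) = top"
      using emeasure_half_line_Iio[of top] by (simp add: greaterThan_def)
    finally show False using fin inverse_sharp_pos[OF assms, of top]
      by (auto simp: ennreal_mult_top split: if_splits)
  qed
  then obtain d where d: "0 < d" "a d \<noteq> 0" by blast
  (* Any point below 1 would do, since m \<ge> r there. *)
  have "a (1/2) \<le> sharp_slope E (ennreal r)"
    unfolding a_def by (intro sharp_slope_antimono assms) (simp add: m_def)
  also have "\<dots> < \<infinity>" using r by (simp add: sharp_slope_def ennreal_divide_eq_top_iff less_top[symmetric])
  finally have young: "young_function (primitive a)"
    using d a by (intro young_function_primitive[of a "1/2" d]) auto

  have "(\<integral>\<^sup>+ x. primitive a (absval f x) \<partial>half_line) = (\<integral>\<^sup>+ l. a l * distribution_fun f l \<partial>half_line)"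
    using nn_integral_primitive_divide[OF f(1) a_borel, of 1] by (simp add: divide_ennreal_def)
  also have "\<dots> \<le> (\<integral>\<^sup>+ l. inverse_sharp E (m l) \<partial>half_line)"
  proof (intro nn_integral_mono)
    fix l
    have "a l * distribution_fun f l \<le> m l * a l"
      unfolding mult.commute[of "a l"] by (intro mult_right_mono) (auto simp: m_def)
    also have "\<dots> \<le> inverse_sharp E (m l)" unfolding a_def by (rule times_sharp_slope_le)
    finally show "a l * distribution_fun f l \<le> inverse_sharp E (m l)" .
  qed
  also note fin
  finally have int: "(\<integral>\<^sup>+ x. primitive a (absval f x) \<partial>half_line) < \<infinity>" .

  have "(\<lambda>x. primitive a (absval f x)) \<in> borel_measurable half_line"
    using f(1) by (intro measurable_primitive[OF a_borel]) measurable
  then have "f \<in> orlicz_space (primitive a)"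
    by (intro orlicz_space_if_integrable young f int)
  moreover have "embeds (orlicz_norm (primitive a)) (lorentz_norm E)"
    using embeds_primitive_sharp_slope[OF assms m fin] by (simp add: a_def[abs_def])
  ultimately show "f \<in> \<Union> {orlicz_space A | A. young_function A \<and> embeds (orlicz_norm A) (lorentz_norm E)}"
    using young by blast
qed

end
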